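(* Let $\nu>0$ and $\lambda>0$ be fixed, and for $r>0$ let $p\in(0,1)$ be determined by $\lambda=r^{\nu}\frac{p}{1-p}$. Let $\mathrm{P}(X=k\mid r,\nu,p)$ denote the probability mass function of a random variable $X$ with the $\mathrm{CMNB}(r,\nu,p)$ distribution. Then $$\lim_{r\to\infty}\mathrm{P}(X=k\mid r,\nu,p)=\frac{\lambda^k}{(k!)^{\nu}}\cdot\frac{1}{Z(\lambda,\nu)},\qquad k=0,1,2,\ldots,$$ where $Z(\lambda,\nu)=\sum_{i=0}^{\infty}\frac{\lambda^i}{(i!)^{\nu}}$.
   Context: For $r,\nu\in(0,\infty)$ and $p\in(0,1)$, a random variable $X$ follows the COM-negative binomial distribution $\mathrm{CMNB}(r,\nu,p)$ if $$\mathrm{P}(X=k)=\left(\frac{\Gamma(r+k)}{k!\,\Gamma(r)}\right)^{\nu}p^k(1-p)^r\frac{1}{C(r,\nu,p)},\quad k=0,1,2,\ldots,\qquad C(r,\nu,p)=\sum_{i=0}^{\infty}\left(\frac{\Gamma(r+i)}{i!\,\Gamma(r)}\right)^{\nu}p^i(1-p)^r .$$ *)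

theory Defs
  imports "HOL-Probability.Probability"
begin

definition cmnb_weight :: "real \<Rightarrow> real \<Rightarrow> real \<Rightarrow> nat \<Rightarrow> real" where
  "cmnb_weight r \<nu> p k =
     (Gamma (r + real k) / (fact k * Gamma r)) powr \<nu> * p ^ k * (1 - p) powr r"

definition cmnb_C :: "real \<Rightarrow> real \<Rightarrow> real \<Rightarrow> real" where
  "cmnb_C r \<nu> p = (\<Sum>i. cmnb_weight r \<nu> p i)"

text \<open>Meaningful for \<open>r > 0\<close>, \<open>\<nu> > 0\<close> and \<open>0 < p < 1\<close>: the lemma \<open>pmf_cmnb_pmf\<close> below
  shows that its mass function is then the intended one.\<close>

definition cmnb_pmf :: "real \<Rightarrow> real \<Rightarrow> real \<Rightarrow> nat pmf" where
  "cmnb_pmf r \<nu> p = embed_pmf (\<lambda>k. cmnb_weight r \<nu> p k / cmnb_C r \<nu> p)"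

definition cmp_Z :: "real \<Rightarrow> real \<Rightarrow> real" where
  "cmp_Z lam \<nu> = (\<Sum>i. lam ^ i / fact i powr \<nu>)"

lemma cmnb_weight_pos:
  assumes "r > 0" "0 < p" "p < 1"
  shows "cmnb_weight r \<nu> p k > 0"
proof -
  have "Gamma (r + real k) > 0" "Gamma r > 0"
    using assms by (auto intro!: Gamma_real_pos)
  then have "Gamma (r + real k) / (fact k * Gamma r) \<noteq> 0"
    by (metis divide_eq_0_iff fact_nonzero less_irrefl mult_eq_0_iff)
  then show ?thesis
    using assms unfolding cmnb_weight_def
    by (intro mult_pos_pos) (simp_all del: divide_eq_0_iff)
qed

lemma cmnb_weight_Suc:
  assumes "r > 0"
  shows "cmnb_weight r \<nu> p (Suc k) =
    ((r + real k) / real (Suc k)) powr \<nu> * p * cmnb_weight r \<nu> p k"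
proof -
  have "r + real k \<notin> \<int>\<^sub>\<le>\<^sub>0"
    using assms by (auto elim!: nonpos_Ints_cases)
  then have "Gamma (r + real (Suc k)) = (r + real k) * Gamma (r + real k)"
    using Gamma_plus1[of "r + real k"] by (simp add: algebra_simps)
  then have "Gamma (r + real (Suc k)) / (fact (Suc k) * Gamma r) =
      ((r + real k) / real (Suc k)) * (Gamma (r + real k) / (fact k * Gamma r))"
    by (simp add: field_simps)
  then have "(Gamma (r + real (Suc k)) / (fact (Suc k) * Gamma r)) powr \<nu> =
      ((r + real k) / real (Suc k)) powr \<nu> * (Gamma (r + real k) / (fact k * Gamma r)) powr \<nu>"
    using assms by (simp only:) (rule powr_mult)
  then show ?thesis
    unfolding cmnb_weight_def by simp
qed

lemma summable_cmnb_weight: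
  assumes "r > 0" "\<nu> > 0" "0 < p" "p < 1"
  shows "summable (cmnb_weight r \<nu> p)"
proof -
  define c where "c = (1 + p) / 2"
  have c: "p < c" "c < 1"
    using assms by (auto simp: c_def)
  have 1: "(\<lambda>k. (r + real k) / real (Suc k)) \<longlonglongrightarrow> 1"
    by real_asymp
  have "(\<lambda>k. ((r + real k) / real (Suc k)) powr \<nu> * p) \<longlonglongrightarrow> 1 powr \<nu> * p"
    by (intro tendsto_intros 1) auto
  then have "(\<lambda>k. ((r + real k) / real (Suc k)) powr \<nu> * p) \<longlonglongrightarrow> p"
    by simp
  then have "eventually (\<lambda>k. ((r + real k) / real (Suc k)) powr \<nu> * p < c) sequentially"
    using c(1) by (rule order_tendstoD)
  then obtain N where N: "\<And>k. k \<ge> N \<Longrightarrow> ((r + real k) / real (Suc k)) powr \<nu> * p < c"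
    by (auto simp: eventually_sequentially)
  show ?thesis
  proof (rule summable_ratio_test[OF c(2)])
    fix k assume "N \<le> k"
    then have "((r + real k) / real (Suc k)) powr \<nu> * p * cmnb_weight r \<nu> p k
        \<le> c * cmnb_weight r \<nu> p k"
      using N[of k] cmnb_weight_pos[of r p \<nu> k] assms by (intro mult_right_mono) auto
    then show "norm (cmnb_weight r \<nu> p (Suc k)) \<le> c * norm (cmnb_weight r \<nu> p k)"
      using cmnb_weight_pos[of r p \<nu>] assms cmnb_weight_Suc[of r \<nu> p k]
      by (simp add: abs_of_pos)
  qed
qed

lemma cmnb_C_pos:
  assumes "r > 0" "\<nu> > 0" "0 < p" "p < 1"
  shows "cmnb_C r \<nu> p > 0"
  unfolding cmnb_C_def
  using assms by (intro suminf_pos summable_cmnb_weight cmnb_weight_pos)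

lemma pmf_cmnb_pmf:
  assumes "r > 0" "\<nu> > 0" "0 < p" "p < 1"
  shows "pmf (cmnb_pmf r \<nu> p) k =
    (Gamma (r + real k) / (fact k * Gamma r)) powr \<nu> * p ^ k * (1 - p) powr r
      * (1 / cmnb_C r \<nu> p)"
proof -
  let ?f = "\<lambda>k. cmnb_weight r \<nu> p k / cmnb_C r \<nu> p"
  have nn: "?f k \<ge> 0" for k
    using cmnb_C_pos[OF assms] cmnb_weight_pos[of r p \<nu> k] assms by simp
  have "?f sums (cmnb_C r \<nu> p / cmnb_C r \<nu> p)"
    unfolding cmnb_C_def using summable_cmnb_weight[OF assms]
    by (intro sums_divide summable_sums)
  then have "?f sums 1"
    using cmnb_C_pos[OF assms] by simp
  then have "(\<integral>\<^sup>+k. ennreal (?f k) \<partial>count_space UNIV) = 1"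
    using nn by (simp add: nn_integral_count_space_nat suminf_ennreal2 sums_iff)
  then have "pmf (cmnb_pmf r \<nu> p) k = ?f k"
    unfolding cmnb_pmf_def using nn by (intro pmf_embed_pmf)
  then show ?thesis
    by (simp add: cmnb_weight_def)
qed

lemma summable_cmp_Z:
  assumes "lam > 0" "\<nu> > 0"
  shows "summable (\<lambda>i. lam ^ i / fact i powr \<nu> :: real)"
proof -
  have "(\<lambda>k. lam / real (Suc k) powr \<nu>) \<longlonglongrightarrow> 0"
    using assms by real_asymp
  then have "eventually (\<lambda>k. lam / real (Suc k) powr \<nu> < 1 / 2) sequentially"
    by (rule order_tendstoD) simp
  then obtain N where N: "\<And>k. k \<ge> N \<Longrightarrow> lam / real (Suc k) powr \<nu> < 1 / 2"
    by (auto simp: eventually_sequentially)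
  show ?thesis
  proof (rule summable_ratio_test[where c = "1 / 2"])
    fix k assume "N \<le> k"
    have "lam ^ Suc k / fact (Suc k) powr \<nu> =
        (lam / real (Suc k) powr \<nu>) * (lam ^ k / fact k powr \<nu>)"
      by (simp add: powr_mult del: of_nat_Suc)
    also have "\<dots> \<le> 1 / 2 * (lam ^ k / fact k powr \<nu>)"
      using N[OF \<open>N \<le> k\<close>] assms by (intro mult_right_mono) auto
    finally show "norm (lam ^ Suc k / fact (Suc k) powr \<nu>)
        \<le> 1 / 2 * norm (lam ^ k / fact k powr \<nu>)"
      using assms by simp
  qed simp
qed

end

theory Submission
  imports Defs
begin

text \<open>Put \<open>u\<^sub>r(k)\<close> for the weight of \<open>k\<close> divided by \<open>(1 - p)\<^sup>r\<close>. Then \<open>u\<^sub>r(0) = 1\<close>, and because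
  \<open>r\<^sup>\<nu> p = \<lambda>(1 - p)\<close> the ratio \<open>u\<^sub>r(k+1) / u\<^sub>r(k)\<close> equals \<open>((1 + k/r) / (k+1))\<^sup>\<nu> \<lambda>(1 - p)\<close>.
  As \<open>p \<rightarrow> 0\<close> this tends to \<open>\<lambda> / (k+1)\<^sup>\<nu>\<close>, which gives pointwise convergence to the
  Conway-Maxwell-Poisson weights. For \<open>r \<ge> 1/\<delta>\<close> the ratio is at most
  \<open>(1/(k+1) + \<delta>)\<^sup>\<nu> \<lambda>\<close>, whose limit in \<open>k\<close> is below \<open>1\<close> for small \<open>\<delta>\<close>; so the \<open>u\<^sub>r\<close> have a common
  summable majorant, and the normalising constants converge by Tannery's theorem.\<close>

text \<open>The factor \<open>(1 - p) powr r\<close> is left out because it need not converge to 1: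
  with p of order lam / r^\<nu> it behaves like exp(-lam r^(1-\<nu>)), which tends to 0 when \<nu> <
  1.\<close>

definition cmnb_uweight :: "real \<Rightarrow> real \<Rightarrow> real \<Rightarrow> nat \<Rightarrow> real" where
  "cmnb_uweight r \<nu> p k = (Gamma (r + real k) / (fact k * Gamma r)) powr \<nu> * p ^ k"

lemma cmnb_weight_eq_uweight:
  "cmnb_weight r \<nu> p k = cmnb_uweight r \<nu> p k * (1 - p) powr r"
  by (simp add: cmnb_weight_def cmnb_uweight_def)

lemma cmnb_uweight_nonneg: "0 \<le> p \<Longrightarrow> 0 \<le> cmnb_uweight r \<nu> p k"
  by (simp add: cmnb_uweight_def)

lemma cmnb_uweight_0:
  assumes "r > 0"
  shows "cmnb_uweight r \<nu> p 0 = 1"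
  using Gamma_real_pos[OF assms] by (simp add: cmnb_uweight_def)

lemma cmnb_uweight_Suc:
  assumes r: "r > 0" and p: "p < 1" and lam: "r powr \<nu> * p = lam * (1 - p)"
  shows "cmnb_uweight r \<nu> p (Suc k) =
    ((1 + real k / r) / real (Suc k)) powr \<nu> * (lam * (1 - p)) * cmnb_uweight r \<nu> p k"
proof -
  have "(r + real k) / real (Suc k) = (1 + real k / r) / real (Suc k) * r"
    using r by (simp add: distrib_right)
  then have "((r + real k) / real (Suc k)) powr \<nu> * p =
      ((1 + real k / r) / real (Suc k)) powr \<nu> * (r powr \<nu> * p)"
    by (simp only: powr_mult mult.assoc)
  \<comment> \<open>This is the recursion of the full weights with \<open>(1 - p) powr r\<close>
    cancelled, which is nonzero since p < 1.\<close>
  moreover have "cmnb_uweight r \<nu> p (Suc k) =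
      ((r + real k) / real (Suc k)) powr \<nu> * p * cmnb_uweight r \<nu> p k"
    using cmnb_weight_Suc[OF r, of \<nu> p k] p
    by (simp add: cmnb_weight_eq_uweight del: of_nat_Suc)
  ultimately show ?thesis
    by (simp only: lam)
qed

text \<open>The factor \<open>(1 - p) powr r\<close> is independent of the index, so it comes out of
  the normalising series and cancels.\<close>

lemma pmf_cmnb_pmf_uweight:
  assumes "r > 0" "\<nu> > 0" "0 < p" "p < 1"
  shows "pmf (cmnb_pmf r \<nu> p) k = cmnb_uweight r \<nu> p k * (1 / (\<Sum>i. cmnb_uweight r \<nu> p i))"
proof -
  have pos: "(1 - p) powr r > 0"
    using assms by simp
  have "summable (\<lambda>i. cmnb_uweight r \<nu> p i * (1 - p) powr r)"
    using summable_cmnb_weight[OF assms] by (simp add: cmnb_weight_eq_uweight[abs_def])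
  then have "summable (cmnb_uweight r \<nu> p)"
    using pos by (simp add: summable_cmult_iff flip: mult.commute[of "(1 - p) powr r"])
  then have "cmnb_C r \<nu> p = (\<Sum>i. cmnb_uweight r \<nu> p i) * (1 - p) powr r"
    by (simp add: cmnb_C_def cmnb_weight_eq_uweight[abs_def] suminf_mult2)
  then show ?thesis
    using pos by (simp add: pmf_cmnb_pmf[OF assms] flip: cmnb_uweight_def)
qed

text \<open>Built as the product of the ratio bounds, it starts at 1 like the weights themselves, so
  comparing ratios by induction is enough to dominate them.\<close>

definition cmnb_majorant :: "real \<Rightarrow> real \<Rightarrow> real \<Rightarrow> nat \<Rightarrow> real" where
  "cmnb_majorant \<nu> lam \<delta> k = (\<Prod>j<k. (1 / real (Suc j) + \<delta>) powr \<nu> * lam)"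

lemma summable_cmnb_majorant:
  assumes "\<delta> > 0" "lam \<ge> 0" "\<delta> powr \<nu> * lam < 1"
  shows "summable (cmnb_majorant \<nu> lam \<delta>)"
proof -
  obtain c where c: "\<delta> powr \<nu> * lam < c" "c < 1"
    using assms(3) dense by blast
  have "(\<lambda>k. 1 / real (Suc k) + \<delta>) \<longlonglongrightarrow> \<delta>"
    by real_asymp
  then have "(\<lambda>k. (1 / real (Suc k) + \<delta>) powr \<nu> * lam) \<longlonglongrightarrow> \<delta> powr \<nu> * lam"
    using assms(1) by (intro tendsto_intros) auto
  then have "eventually (\<lambda>k. (1 / real (Suc k) + \<delta>) powr \<nu> * lam < c) sequentially"
    using c(1) by (rule order_tendstoD)
  then obtain N where N: "\<And>k. k \<ge> N \<Longrightarrow> (1 / real (Suc k) + \<delta>) powr \<nu> * lam < c"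
    by (auto simp: eventually_sequentially)
  have nn: "cmnb_majorant \<nu> lam \<delta> k \<ge> 0" for k
    unfolding cmnb_majorant_def using assms(2) by (intro prod_nonneg) auto
  show ?thesis
  proof (rule summable_ratio_test[OF c(2)])
    fix k assume "N \<le> k"
    then have "cmnb_majorant \<nu> lam \<delta> k * ((1 / real (Suc k) + \<delta>) powr \<nu> * lam)
        \<le> cmnb_majorant \<nu> lam \<delta> k * c"
      using N[of k] nn[of k] by (intro mult_left_mono) auto
    then show "norm (cmnb_majorant \<nu> lam \<delta> (Suc k)) \<le> c * norm (cmnb_majorant \<nu> lam \<delta> k)"
      using nn[of k] nn[of "Suc k"] by (simp add: cmnb_majorant_def mult.commute)
  qed
qed

lemma cmnb_uweight_le_majorant:
  assumes "r > 0" "1 / r \<le> \<delta>" "\<nu> > 0" "0 < p" "p < 1" "lam \<ge> 0"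
    and lam: "r powr \<nu> * p = lam * (1 - p)"
  shows "cmnb_uweight r \<nu> p k \<le> cmnb_majorant \<nu> lam \<delta> k"
proof (induction k)
  case 0
  then show ?case
    using assms by (simp add: cmnb_uweight_0 cmnb_majorant_def)
next
  case (Suc k)
  \<comment> \<open>Splitting off 1/(k+1) leaves 1/r times k/(k+1) < 1, so a single \<delta> \<ge>
    1/r serves every k.\<close>
  have "(1 + real k / r) / real (Suc k) = 1 / real (Suc k) + real k / real (Suc k) * (1 / r)"
    by (simp add: add_divide_distrib)
  also have "real k / real (Suc k) * (1 / r) \<le> 1 * (1 / r)"
    using assms(1) by (intro mult_right_mono) auto
  finally have "(1 + real k / r) / real (Suc k) \<le> 1 / real (Suc k) + \<delta>"
    using assms(2) by simp
  then have "((1 + real k / r) / real (Suc k)) powr \<nu> \<le> (1 / real (Suc k) + \<delta>) powr \<nu>"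
    using assms by (intro powr_mono2) auto
  moreover have "lam * (1 - p) \<le> lam"
    using assms by (simp add: mult_left_le)
  ultimately have "((1 + real k / r) / real (Suc k)) powr \<nu> * (lam * (1 - p)) * cmnb_uweight r \<nu> p k
      \<le> (1 / real (Suc k) + \<delta>) powr \<nu> * lam * cmnb_majorant \<nu> lam \<delta> k"
    using assms Suc.IH by (intro mult_mono) (auto intro: cmnb_uweight_nonneg)
  then show ?case
    using assms by (simp add: cmnb_uweight_Suc[OF _ _ lam] cmnb_majorant_def mult_ac)
qed

lemma tendsto_cmnb_uweight:
  assumes p: "\<And>r. r > 0 \<Longrightarrow> p r < 1"
    and lam: "\<And>r. r > 0 \<Longrightarrow> r powr \<nu> * p r = lam * (1 - p r)"
    and p0: "(p \<longlongrightarrow> 0) at_top"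
  shows "((\<lambda>r. cmnb_uweight r \<nu> (p r) k) \<longlongrightarrow> lam ^ k / fact k powr \<nu>) at_top"
proof (induction k)
  case 0
  have "eventually (\<lambda>r. 1 = cmnb_uweight r \<nu> (p r) 0) at_top"
    using eventually_gt_at_top[of 0] by eventually_elim (simp add: cmnb_uweight_0)
  then have "((\<lambda>r. cmnb_uweight r \<nu> (p r) 0) \<longlongrightarrow> 1) at_top"
    by (rule Lim_transform_eventually[OF tendsto_const])
  then show ?case by simp
next
  case (Suc k)
  have "((\<lambda>r. 1 + real k / r) \<longlongrightarrow> 1) at_top"
    by real_asymp
  \<comment> \<open>The limit is taken of the right side of the recursion, which agrees with the
    next weight only for r > 0; hence the transfer along \<open>at_top\<close> below.\<close>
  then have "((\<lambda>r. ((1 + real k / r) / real (Suc k)) powr \<nu> * (lam * (1 - p r))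
        * cmnb_uweight r \<nu> (p r) k)
      \<longlongrightarrow> (1 / real (Suc k)) powr \<nu> * (lam * (1 - 0)) * (lam ^ k / fact k powr \<nu>)) at_top"
    by (intro tendsto_mult tendsto_powr tendsto_divide tendsto_diff tendsto_const p0 Suc.IH) auto
  also have "(1 / real (Suc k)) powr \<nu> * (lam * (1 - 0)) * (lam ^ k / fact k powr \<nu>) =
      lam ^ Suc k / fact (Suc k) powr \<nu>"
    by (simp add: powr_mult powr_divide del: of_nat_Suc)
  finally show ?case
  proof (rule Lim_transform_eventually)
    show "eventually (\<lambda>r. ((1 + real k / r) / real (Suc k)) powr \<nu> * (lam * (1 - p r))
        * cmnb_uweight r \<nu> (p r) k = cmnb_uweight r \<nu> (p r) (Suc k)) at_top"
      using eventually_gt_at_top[of 0]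
      by eventually_elim (rule cmnb_uweight_Suc[OF _ p lam, symmetric])
  qed
qed

theorem theorem2p4:
  fixes \<nu> lam :: real and p :: "real \<Rightarrow> real" and k :: nat
  assumes "\<nu> > 0" and "lam > 0"
    and "\<And>r. r > 0 \<Longrightarrow> 0 < p r \<and> p r < 1"
    and "\<And>r. r > 0 \<Longrightarrow> lam = r powr \<nu> * (p r / (1 - p r))"
  shows "((\<lambda>r. pmf (cmnb_pmf r \<nu> (p r)) k) \<longlongrightarrow>
           lam ^ k / fact k powr \<nu> * (1 / cmp_Z lam \<nu>)) at_top"
proof -
  have p: "0 < p r" "p r < 1" if "r > 0" for r
    using assms(3)[OF that] by auto
  have lam: "r powr \<nu> * p r = lam * (1 - p r)" if "r > 0" for r
    using p[OF that] by (subst assms(4)[OF that]) simp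
  \<comment> \<open>Solving the constraint for p gives p = lam / (r^\<nu> + lam), which vanishes in
    the limit since \<nu> > 0.\<close>
  have "((\<lambda>r. lam / (r powr \<nu> + lam)) \<longlongrightarrow> 0) at_top"
    using assms(1,2) by real_asymp
  moreover have "eventually (\<lambda>r. lam / (r powr \<nu> + lam) = p r) at_top"
    using eventually_gt_at_top[of 0]
  proof eventually_elim
    case (elim r)
    have "r powr \<nu> + lam > 0"
      using assms(2) by (simp add: add_nonneg_pos)
    then show ?case
      using lam[OF elim] by (simp add: field_simps)
  qed
  ultimately have p0: "(p \<longlongrightarrow> 0) at_top"
    by (rule Lim_transform_eventually)
  have lim: "((\<lambda>r. cmnb_uweight r \<nu> (p r) i) \<longlongrightarrow> lam ^ i / fact i powr \<nu>) at_top" for i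
    using p(2) lam p0 by (rule tendsto_cmnb_uweight)

  \<comment> \<open>Chosen so that \<delta>^\<nu> lam = 1/2.\<close>
  define \<delta> where "\<delta> = (1 / (2 * lam)) powr (1 / \<nu>)"
  have \<delta>: "\<delta> > 0" "\<delta> powr \<nu> * lam < 1"
    using assms(1,2) by (simp_all add: \<delta>_def powr_powr)
  have "eventually (\<lambda>r. \<forall>i. norm (cmnb_uweight r \<nu> (p r) i) \<le> cmnb_majorant \<nu> lam \<delta> i) at_top"
    using eventually_gt_at_top[of 0] eventually_ge_at_top[of "1 / \<delta>"]
  proof eventually_elim
    case (elim r)
    have "1 / r \<le> \<delta>"
      using elim \<delta>(1) by (simp add: field_simps)
    then show ?case
      using elim(1) assms(1,2) p[OF elim(1)] lam[OF elim(1)]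
      by (auto simp: cmnb_uweight_nonneg intro!: cmnb_uweight_le_majorant)
  qed
  \<comment> \<open>\<open>tannerys_theorem\<close> asks for the bound along the product filter. It
    already holds for all indices at once, so the index component is unrestricted.\<close>
  then have "eventually (\<lambda>(i, r). norm (cmnb_uweight r \<nu> (p r) i) \<le> cmnb_majorant \<nu> lam \<delta> i)
      (at_top \<times>\<^sub>F at_top)"
    unfolding eventually_prod_filter
    by (intro exI[of _ "\<lambda>_. True"] exI[of _ "\<lambda>r. \<forall>i. norm (cmnb_uweight r \<nu> (p r) i) \<le> cmnb_majorant \<nu> lam \<delta> i"]) auto
  then have "((\<lambda>r. \<Sum>i. cmnb_uweight r \<nu> (p r) i) \<longlongrightarrow> cmp_Z lam \<nu>) at_top"
    using tannerys_theorem[OF lim _ summable_cmnb_majorant[of \<delta> lam \<nu>]] \<delta> assms(2)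
    by (simp add: cmp_Z_def)
  \<comment> \<open>A nonzero limit is what allows passing to the reciprocal of the normalising
    series.\<close>
  moreover have "cmp_Z lam \<nu> > 0"
    unfolding cmp_Z_def using assms by (intro suminf_pos summable_cmp_Z) auto
  ultimately have "((\<lambda>r. cmnb_uweight r \<nu> (p r) k * (1 / (\<Sum>i. cmnb_uweight r \<nu> (p r) i)))
      \<longlongrightarrow> lam ^ k / fact k powr \<nu> * (1 / cmp_Z lam \<nu>)) at_top"
    by (intro tendsto_intros lim) auto
  moreover have "eventually (\<lambda>r. cmnb_uweight r \<nu> (p r) k * (1 / (\<Sum>i. cmnb_uweight r \<nu> (p r) i))
      = pmf (cmnb_pmf r \<nu> (p r)) k) at_top"
    using eventually_gt_at_top[of 0]
    by eventually_elim (use assms(1) p in \<open>simp add: pmf_cmnb_pmf_uweight\<close>)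
  ultimately show ?thesis
    by (rule Lim_transform_eventually)
qed

end
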